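(* Let $d=(d_n)_{n\ge0}$ be a monotonic increasing, unbounded sequence of positive real numbers such that, for some constant $c\neq0$, $\lim_{l\to\infty}\frac{d_l}{d_{n+l}}=c$ for all $n\in\mathbb N_0$. Then: (i) $\mathscr M(bs_d)=\ell^1$; (ii) if $a\in\ell^1$, then $c\,\|a\|_{\ell^1}\le\|T_a\|_{\mathcal B(bs_d)}\le\|a\|_{\ell^1}$.
   Context: All sequences are complex and indexed by $\mathbb N_0=\{0,1,2,\dots\}$. $bs_d=\{x\in\mathbb C^{\mathbb N_0}:\|x\|_{bs_d}=\sup_m\frac1{d_m}|\sum_{k=0}^m x_k|<\infty\}$, a Banach space under $\|\cdot\|_{bs_d}$. The convolution is $(a*x)_n=\sum_{k=0}^n a_{n-k}x_k$. The multiplier of a sequence space $X$ is $\mathscr M(X)=\{a\in\mathbb C^{\mathbb N_0}: a*x\in X\text{ for all }x\in X\}$. For $a\in\ell^1$ (absolutely summable sequences; one has $\ell^1\subseteq\mathscr M(bs_d)$), $T_a:bs_d\to bs_d$ is $T_a(x)=a*x$, and $\|T_a\|_{\mathcal B(bs_d)}$ is its operator norm. *)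

theory Defs
  imports Complex_Main "HOL-Library.Extended_Real"
begin

text \<open>
  The norm of \<open>bs\<^sub>d\<close> and the operator norm are suprema in the extended reals, so that no default
  value arises where a supremum is infinite.  In particular, a finite upper bound on \<open>op_norm\<close>
  includes the boundedness of the operator.
\<close>

definition bs_norm :: "(nat \<Rightarrow> real) \<Rightarrow> (nat \<Rightarrow> complex) \<Rightarrow> ereal"
  where "bs_norm d x = (SUP m. ereal (1 / d m * cmod (\<Sum>k\<le>m. x k)))"

definition bs :: "(nat \<Rightarrow> real) \<Rightarrow> (nat \<Rightarrow> complex) set"
  where "bs d = {x. bs_norm d x < \<infinity>}"

definition conv :: "(nat \<Rightarrow> complex) \<Rightarrow> (nat \<Rightarrow> complex) \<Rightarrow> (nat \<Rightarrow> complex)"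
  where "conv a x = (\<lambda>n. \<Sum>k\<le>n. a (n - k) * x k)"

definition multiplier :: "(nat \<Rightarrow> complex) set \<Rightarrow> (nat \<Rightarrow> complex) set"
  where "multiplier X = {a. \<forall>x\<in>X. conv a x \<in> X}"

definition ell1 :: "(nat \<Rightarrow> complex) set"
  where "ell1 = {a. summable (\<lambda>n. cmod (a n))}"

definition ell1_norm :: "(nat \<Rightarrow> complex) \<Rightarrow> real"
  where "ell1_norm a = (\<Sum>n. cmod (a n))"

definition op_norm ::
  "(nat \<Rightarrow> complex) set \<Rightarrow> ((nat \<Rightarrow> complex) \<Rightarrow> ereal) \<Rightarrow> ((nat \<Rightarrow> complex) \<Rightarrow> (nat \<Rightarrow> complex)) \<Rightarrow> ereal"
  where "op_norm X N T = (SUP x\<in>{x \<in> X. N x \<le> 1}. N (T x))"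

end

theory Submission
  imports Defs
begin

text \<open>
  Partial summation turns \<open>bs\<^sub>d\<close> into the space of sequences \<open>y\<close> with \<open>\<bar>y\<^sub>m\<bar> = O(d\<^sub>m)\<close> and commutes
  with convolution.  The functional \<open>y \<mapsto> (a * y)\<^sub>m / d\<^sub>m\<close> then has norm
  \<open>\<Sum>k\<le>m. \<bar>a\<^sub>k\<bar> d\<^sub>m\<^sub>-\<^sub>k / d\<^sub>m\<close>, attained at \<open>y\<^sub>j = cnj (sgn a\<^sub>m\<^sub>-\<^sub>j) d\<^sub>j\<close>.  It is at most \<open>\<parallel>a\<parallel>\<close> by monotonicity,
  and by the limit hypothesis it eventually exceeds every number below \<open>c \<parallel>a\<parallel>\<close>.  That a multiplier
  is summable follows by a gliding hump: if \<open>a\<close> is not summable, a single \<open>y\<close> that agrees with these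
  extremal sequences on successive blocks makes \<open>(a * y)\<^sub>m / d\<^sub>m\<close> unbounded.
\<close>

section \<open>Partial summation and its compatibility with convolution\<close>

definition psum :: "(nat \<Rightarrow> complex) \<Rightarrow> nat \<Rightarrow> complex"
  where "psum x m = (\<Sum>k\<le>m. x k)"

definition pdiff :: "(nat \<Rightarrow> complex) \<Rightarrow> nat \<Rightarrow> complex"
  where "pdiff y n = y n - (if n = 0 then 0 else y (n - 1))"

text \<open>The sum of the overview under k = m - j; indexing by the position j of the argument
  matches \<open>conv\<close>.\<close>

definition functional_norm :: "(nat \<Rightarrow> real) \<Rightarrow> (nat \<Rightarrow> complex) \<Rightarrow> nat \<Rightarrow> real"
  where "functional_norm d a m = (\<Sum>j\<le>m. cmod (a (m - j)) * d j) / d m"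

lemma psum_pdiff [simp]: "psum (pdiff y) = y"
proof
  fix m show "psum (pdiff y) m = y m"
    by (induction m) (simp_all add: psum_def pdiff_def)
qed

lemma sum_atMost_diff_swap:
  fixes f :: "nat \<Rightarrow> nat \<Rightarrow> 'a::comm_monoid_add"
  shows "(\<Sum>k\<le>n. f (n - k) k) = (\<Sum>k\<le>n. f k (n - k))"
  by (rule sum.reindex_bij_witness[where i = "\<lambda>k. n - k" and j = "\<lambda>k. n - k"]) auto

lemma conv_Suc: "conv a x (Suc m) = a (Suc m) * x 0 + conv a (\<lambda>k. x (Suc k)) m"
  by (simp add: conv_def sum.atMost_Suc_shift del: sum.atMost_Suc)

text \<open>Taking partial sums is convolution with the constant sequence 1, and convolution is
  associative and commutative. The induction splits off \<open>x 0\<close> and applies the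
  hypothesis to the shifted sequence.\<close>

lemma psum_conv: "psum (conv a x) m = conv a (psum x) m"
proof (induction m arbitrary: x)
  case 0
  show ?case by (simp add: psum_def conv_def)
next
  case (Suc m)
  have shift: "conv a (\<lambda>k. psum x (Suc k)) n
      = x 0 * (\<Sum>k\<le>n. a k) + conv a (psum (\<lambda>k. x (Suc k))) n" for n
  proof -
    have "psum x (Suc k) = x 0 + psum (\<lambda>k. x (Suc k)) k" for k
      by (simp add: psum_def sum.atMost_Suc_shift del: sum.atMost_Suc)
    then have "conv a (\<lambda>k. psum x (Suc k)) n
        = (\<Sum>k\<le>n. a (n - k) * x 0) + conv a (psum (\<lambda>k. x (Suc k))) n"
      by (simp add: conv_def distrib_left sum.distrib)
    also have "(\<Sum>k\<le>n. a (n - k) * x 0) = x 0 * (\<Sum>k\<le>n. a k)"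
      using sum_atMost_diff_swap[of "\<lambda>i k. a i * x 0" n] by (simp add: sum_distrib_left mult.commute)
    finally show ?thesis .
  qed
  have "psum (conv a x) (Suc m) = conv a x 0 + (\<Sum>k\<le>m. conv a x (Suc k))"
    by (simp add: psum_def sum.atMost_Suc_shift del: sum.atMost_Suc)
  also have "\<dots> = a 0 * x 0 + (\<Sum>k\<le>m. a (Suc k)) * x 0 + psum (conv a (\<lambda>k. x (Suc k))) m"
    by (simp add: conv_Suc sum.distrib psum_def sum_distrib_right) (simp add: conv_def)
  also have "\<dots> = (\<Sum>k\<le>Suc m. a k) * x 0 + conv a (psum (\<lambda>k. x (Suc k))) m"
    by (simp only: Suc sum.atMost_Suc_shift distrib_right)
  also have "\<dots> = conv a (psum x) (Suc m)"
    unfolding conv_Suc shift by (simp add: psum_def algebra_simps)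
  finally show ?case .
qed

section \<open>Membership in the space as a growth bound, and the upper bound for
  convolution\<close>

lemma bs_norm_le_iff:
  assumes "\<And>n. d n > 0"
  shows "bs_norm d x \<le> ereal C \<longleftrightarrow> (\<forall>m. cmod (psum x m) \<le> C * d m)"
proof -
  have "1 / d m * cmod (psum x m) \<le> C \<longleftrightarrow> cmod (psum x m) \<le> C * d m" for m
    using pos_divide_le_eq[OF assms[of m]] by simp
  then show ?thesis
    by (simp add: bs_norm_def SUP_le_iff flip: psum_def)
qed

lemma bs_iff:
  assumes "\<And>n. d n > 0"
  shows "x \<in> bs d \<longleftrightarrow> (\<exists>C. \<forall>m. cmod (psum x m) \<le> C * d m)"
proof
  assume "x \<in> bs d"
  \<comment> \<open>The term at index 0 rules out the value -\<infinity> for the supremum.\<close>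
  moreover have "ereal (1 / d 0 * cmod (\<Sum>k\<le>0. x k)) \<le> bs_norm d x"
    unfolding bs_norm_def by (rule SUP_upper) simp
  ultimately obtain C where "bs_norm d x = ereal C"
    by (cases "bs_norm d x") (auto simp: bs_def)
  then show "\<exists>C. \<forall>m. cmod (psum x m) \<le> C * d m"
    using bs_norm_le_iff[of d x C, OF assms] by auto
next
  assume "\<exists>C. \<forall>m. cmod (psum x m) \<le> C * d m"
  then obtain C where "bs_norm d x \<le> ereal C"
    using bs_norm_le_iff[of d, OF assms] by blast
  then show "x \<in> bs d"
    by (auto simp: bs_def)
qed

text \<open>Monotonicity bounds every weight \<open>d k\<close> with k \<le> m by
  \<open>d m\<close>, so only a partial sum of the cmod (a k) remains.\<close>

lemma cmod_conv_le:
  assumes "\<And>n. d n > 0" and "incseq d" and a: "a \<in> ell1"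
    and y: "\<And>m. cmod (y m) \<le> C * d m"
  shows "cmod (conv a y m) \<le> C * ell1_norm a * d m"
proof -
  have C: "C \<ge> 0"
    using order_trans[OF norm_ge_zero y[of 0]] assms(1)[of 0] by (simp add: zero_le_mult_iff)
  have "cmod (conv a y m) \<le> (\<Sum>k\<le>m. cmod (a (m - k)) * cmod (y k))"
    unfolding conv_def by (rule order_trans[OF norm_sum]) (simp add: norm_mult)
  also have "\<dots> \<le> (\<Sum>k\<le>m. cmod (a (m - k)) * (C * d m))"
  proof (intro sum_mono mult_left_mono)
    fix k assume "k \<in> {..m}"
    then have "C * d k \<le> C * d m"
      using C \<open>incseq d\<close> by (intro mult_left_mono) (auto simp: incseq_def)
    then show "cmod (y k) \<le> C * d m" using y[of k] by linarith
  qed auto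
  also have "\<dots> = (\<Sum>k\<le>m. cmod (a k)) * (C * d m)"
    using sum_atMost_diff_swap[of "\<lambda>i k. cmod (a i)" m]
    by (simp add: sum_distrib_right[symmetric])
  also have "\<dots> \<le> ell1_norm a * (C * d m)"
  proof (rule mult_right_mono)
    show "(\<Sum>k\<le>m. cmod (a k)) \<le> ell1_norm a"
      unfolding ell1_norm_def using a by (intro sum_le_suminf) (auto simp: ell1_def)
    show "0 \<le> C * d m" using C assms(1)[of m] by simp
  qed
  finally show ?thesis by (simp add: mult_ac)
qed

section \<open>Lower bounds from extremal sequences\<close>

text \<open>Keep only the K terms with k < K; each weight \<open>d (m - k) / d m\<close> tends to c.
  The finite sum in the bound lets this serve both summable and non-summable a.\<close>

lemma eventually_functional_norm_gt:
  assumes pos: "\<And>n. d n > 0" and lim: "\<And>n. (\<lambda>l. d l / d (n + l)) \<longlonglongrightarrow> c"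
    and B: "B < c * (\<Sum>k<K. cmod (a k))"
  shows "eventually (\<lambda>m. functional_norm d a m > B) sequentially"
proof -
  have "(\<lambda>m. d (m - k) / d m) \<longlonglongrightarrow> c" for k
    by (rule LIMSEQ_offset[where k = k]) (use lim[of k] in \<open>simp add: add.commute\<close>)
  then have "(\<lambda>m. \<Sum>k<K. cmod (a k) * (d (m - k) / d m)) \<longlonglongrightarrow> (\<Sum>k<K. cmod (a k) * c)"
    by (intro tendsto_sum tendsto_mult_left)
  then have "eventually (\<lambda>m. B < (\<Sum>k<K. cmod (a k) * (d (m - k) / d m))) sequentially"
    by (rule order_tendstoD) (use B in \<open>simp add: sum_distrib_left mult.commute\<close>)
  then show ?thesis
    using eventually_ge_at_top[of K]
  proof eventually_elim
    case (elim m)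
    have "(\<Sum>k<K. cmod (a k) * (d (m - k) / d m)) \<le> (\<Sum>k\<le>m. cmod (a k) * (d (m - k) / d m))"
      using \<open>K \<le> m\<close> pos by (intro sum_mono2) (auto simp: less_imp_le)
    also have "\<dots> = functional_norm d a m"
      using sum_atMost_diff_swap[of "\<lambda>i k. cmod (a i) * d k" m]
      by (simp add: functional_norm_def sum_divide_distrib)
    finally show ?case using elim by simp
  qed
qed

lemma mult_cnj_sgn: "z * cnj (sgn z) = complex_of_real (cmod z)"
proof -
  have "z * cnj (sgn z) = (z * cnj z) / complex_of_real (cmod z)"
    by (simp add: sgn_eq)
  also have "z * cnj z = complex_of_real (cmod z) * complex_of_real (cmod z)"
    unfolding complex_norm_square[symmetric] by (simp add: power2_eq_square)
  finally show ?thesis by simp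
qed

lemma cmod_cnj_sgn_le: "cmod (cnj (sgn z)) \<le> 1"
  by (simp add: norm_sgn)

lemma functional_norm_le_op_norm:
  assumes pos: "\<And>n. d n > 0"
  shows "ereal (functional_norm d a m) \<le> op_norm (bs d) (bs_norm d) (conv a)"
proof -
  \<comment> \<open>The phases make all terms of \<open>conv a y m\<close> nonnegative. For j > m
    the subtraction truncates to 0, and there only the bound by \<open>d j\<close> matters.\<close>
  define y where "y j = cnj (sgn (a (m - j))) * complex_of_real (d j)" for j
  have "cmod (y j) \<le> 1 * d j" for j
    unfolding y_def norm_mult using cmod_cnj_sgn_le pos[of j] by (intro mult_mono) auto
  then have le1: "bs_norm d (pdiff y) \<le> ereal 1"
    unfolding bs_norm_le_iff[of d, OF pos] by simp
  then have "pdiff y \<in> bs d"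
    by (auto simp: bs_def)
  have "conv a y m = (\<Sum>j\<le>m. complex_of_real (cmod (a (m - j)) * d j))"
    by (simp add: conv_def y_def mult.assoc[symmetric] mult_cnj_sgn)
  also have "\<dots> = complex_of_real (functional_norm d a m * d m)"
    using pos[of m] by (simp add: functional_norm_def)
  finally have y_eq: "conv a y m = complex_of_real (functional_norm d a m * d m)" .
  have "cmod (conv a y m) = functional_norm d a m * d m"
    unfolding y_eq norm_of_real functional_norm_def
    by (intro abs_of_nonneg mult_nonneg_nonneg divide_nonneg_nonneg sum_nonneg)
      (auto intro: less_imp_le[OF pos])
  then have "functional_norm d a m = 1 / d m * cmod (psum (conv a (pdiff y)) m)"
    using pos[of m] by (simp add: psum_conv)
  then have "ereal (functional_norm d a m) \<le> bs_norm d (conv a (pdiff y))"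
    unfolding bs_norm_def psum_def by (metis (no_types, lifting) SUP_upper UNIV_I)
  also have "\<dots> \<le> op_norm (bs d) (bs_norm d) (conv a)"
    unfolding op_norm_def using le1 \<open>pdiff y \<in> bs d\<close> by (intro SUP_upper) (auto simp: one_ereal_def)
  finally show ?thesis .
qed

section \<open>The gliding hump argument\<close>

lemma ell1_if_multiplier:
  assumes pos: "\<And>n. d n > 0" and inc: "incseq d" and "c > 0"
    and lim: "\<And>n. (\<lambda>l. d l / d (n + l)) \<longlonglongrightarrow> c"
    and mult: "a \<in> multiplier (bs d)"
  shows "a \<in> ell1"
proof (rule ccontr)
  assume "a \<notin> ell1"
  have conv_bdd: "\<exists>C. \<forall>m. cmod (conv a y m) \<le> C * d m" if "\<And>m. cmod (y m) \<le> C * d m" for y C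
  proof -
    have "pdiff y \<in> bs d" using that by (auto simp: bs_iff[of d, OF pos])
    then have "conv a (pdiff y) \<in> bs d" using mult by (auto simp: multiplier_def)
    then show ?thesis by (simp add: bs_iff[of d, OF pos] psum_conv)
  qed
  \<comment> \<open>Convolution with the unit sequence at 0 returns a, so a itself grows at most
    like d. This crude bound will control the earlier blocks.\<close>
  have "\<exists>C. \<forall>m. cmod (conv a (\<lambda>k. if k = 0 then 1 else 0) m) \<le> C * d m"
    by (rule conv_bdd[of _ "1 / d 0"]) (use pos in \<open>auto simp: field_simps less_imp_le\<close>)
  then obtain C where C: "\<And>m. cmod (a m) \<le> C * d m"
    by (auto simp: conv_def if_distrib cong: if_cong)
  have "C \<ge> 0"
    using order_trans[OF norm_ge_zero C[of 0]] pos[of 0] by (simp add: zero_le_mult_iff)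

  have "\<exists>M>p. functional_norm d a M > B" for p B
  proof -
    have "\<exists>K. B / c < (\<Sum>k<K. cmod (a k))"
    proof (rule ccontr)
      assume "\<not> ?thesis"
      then have "summable (\<lambda>n. cmod (a n))"
        by (intro summableI_nonneg_bounded[where x = "B / c"]) (auto simp: not_less)
      with \<open>a \<notin> ell1\<close> show False by (simp add: ell1_def)
    qed
    then obtain K where "B < c * (\<Sum>k<K. cmod (a k))"
      using \<open>c > 0\<close> by (auto simp: field_simps)
    from eventually_functional_norm_gt[of d, OF pos lim this] eventually_gt_at_top[of p]
    have "eventually (\<lambda>M. functional_norm d a M > B \<and> p < M) sequentially"
      by eventually_elim simp
    then show ?thesis by (auto simp: eventually_sequentially)
  qed
  \<comment> \<open>The indices up to \<open>f n\<close> contribute at most C times the sum of the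
    \<open>d j\<close>, relative to d at the new index. This is lost twice: the block omits these
    terms of the extremal sum, and they may point against the block. Hence the factor 2, with a
    surplus n remaining.\<close>
  then have "\<exists>f. \<forall>n. True \<and> (f n < f (Suc n) \<and>
      functional_norm d a (f (Suc n)) > real n + 2 * C * (\<Sum>j\<le>f n. d j))"
    by (intro dependent_nat_choice) auto
  then obtain M :: "nat \<Rightarrow> nat" where M: "\<And>n. M n < M (Suc n)"
    and big: "\<And>n. functional_norm d a (M (Suc n)) > real n + 2 * C * (\<Sum>j\<le>M n. d j)"
    by blast
  have "strict_mono M" using M by (simp add: strict_mono_Suc_iff)
  \<comment> \<open>The \<open>LEAST\<close> finds the block of j: on (\<open>M n\<close>,
    \<open>M (Suc n)\<close>] it equals \<open>Suc n\<close>, so y has the phases extremal for index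
    \<open>M (Suc n)\<close>.\<close>
  define y where
    "y j = cnj (sgn (a (M (LEAST i. j \<le> M i) - j))) * complex_of_real (d j)" for j
  have y_le: "cmod (y j) \<le> d j" for j
  proof -
    have "cmod (y j) \<le> 1 * d j"
      unfolding y_def norm_mult using cmod_cnj_sgn_le pos[of j] by (intro mult_mono) auto
    then show ?thesis by simp
  qed
  have y_block: "a (M (Suc n) - j) * y j = complex_of_real (cmod (a (M (Suc n) - j)) * d j)"
    if "M n < j" "j \<le> M (Suc n)" for n j
  proof -
    have "(LEAST i. j \<le> M i) = Suc n"
    proof (rule Least_equality)
      fix i assume "j \<le> M i"
      then have "M n < M i" using that by simp
      then show "Suc n \<le> i" using \<open>strict_mono M\<close> by (simp add: strict_mono_less Suc_le_eq)
    qed (use that in simp)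
    then show ?thesis by (simp add: y_def mult.assoc[symmetric] mult_cnj_sgn)
  qed
  have large: "cmod (conv a y (M (Suc n))) > real n * d (M (Suc n))" for n
  proof -
    let ?N = "M (Suc n)"
    let ?A = "\<Sum>j\<le>M n. cmod (a (?N - j)) * d j"
    have split: "(\<Sum>j\<le>?N. f j) = (\<Sum>j\<le>M n. f j) + (\<Sum>j\<in>{M n<..?N}. f j)"
      for f :: "nat \<Rightarrow> 'b::comm_monoid_add"
    proof -
      have "{..?N} = {..M n} \<union> {M n<..?N}" using M[of n] by auto
      then show ?thesis by (simp add: sum.union_disjoint Int_def)
    qed
    have "?A \<le> (\<Sum>j\<le>M n. C * d ?N * d j)"
    proof (intro sum_mono mult_right_mono)
      fix j
      have "C * d (?N - j) \<le> C * d ?N"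
        using \<open>C \<ge> 0\<close> inc by (intro mult_left_mono) (auto simp: incseq_def)
      then show "cmod (a (?N - j)) \<le> C * d ?N" using C[of "?N - j"] by linarith
    qed (simp add: pos less_imp_le)
    then have A: "?A \<le> C * (\<Sum>j\<le>M n. d j) * d ?N"
      by (simp add: sum_distrib_left sum_distrib_right mult_ac)
    have low: "cmod (\<Sum>j\<le>M n. a (?N - j) * y j) \<le> ?A"
      by (rule order_trans[OF norm_sum], rule sum_mono)
        (simp add: norm_mult mult_left_mono y_le)
    have "(\<Sum>j\<in>{M n<..?N}. a (?N - j) * y j)
        = complex_of_real (\<Sum>j\<in>{M n<..?N}. cmod (a (?N - j)) * d j)"
      unfolding of_real_sum by (intro sum.cong) (auto simp: y_block)
    also have "cmod \<dots> = (\<Sum>j\<in>{M n<..?N}. cmod (a (?N - j)) * d j)"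
      unfolding norm_of_real by (rule abs_of_nonneg) (simp add: sum_nonneg pos less_imp_le)
    also have "\<dots> = functional_norm d a ?N * d ?N - ?A"
      using split[of "\<lambda>j. cmod (a (?N - j)) * d j"] pos[of ?N] by (simp add: functional_norm_def)
    finally have high: "cmod (\<Sum>j\<in>{M n<..?N}. a (?N - j) * y j)
        = functional_norm d a ?N * d ?N - ?A" .
    have "(real n + 2 * C * (\<Sum>j\<le>M n. d j)) * d ?N < functional_norm d a ?N * d ?N"
      using big[of n] pos[of ?N] by (rule mult_strict_right_mono)
    then have "real n * d ?N < functional_norm d a ?N * d ?N - ?A - ?A"
      using A by (simp add: distrib_right)
    also have "\<dots> \<le> cmod (conv a y ?N)"
      unfolding conv_def split using low high
        norm_diff_ineq[of "\<Sum>j\<in>{M n<..?N}. a (?N - j) * y j" "\<Sum>j\<le>M n. a (?N - j) * y j"]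
      by (simp add: add.commute)
    finally show ?thesis .
  qed
  obtain D where D: "\<And>m. cmod (conv a y m) \<le> D * d m"
    using conv_bdd[of y 1] y_le by auto
  obtain n where "D < real n" using reals_Archimedean2 by blast
  then have "D * d (M (Suc n)) < real n * d (M (Suc n))"
    using pos by simp
  then show False using large[of n] D[of "M (Suc n)"] by linarith
qed

theorem theorem5p7:
  fixes d :: "nat \<Rightarrow> real" and c :: real
  assumes "\<And>n. d n > 0"
    and "incseq d"
    and "\<not> bdd_above (range d)"
    and "c \<noteq> 0"
    and "\<And>n. (\<lambda>l. d l / d (n + l)) \<longlonglongrightarrow> c"
  shows "multiplier (bs d) = ell1 \<and>
    (\<forall>a\<in>ell1.
      ereal (c * ell1_norm a) \<le> op_norm (bs d) (bs_norm d) (conv a) \<and>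
      op_norm (bs d) (bs_norm d) (conv a) \<le> ereal (ell1_norm a))"
proof -
  note pos = assms(1) and inc = assms(2) and lim = assms(5)
  \<comment> \<open>c is a limit of positive quotients.\<close>
  have "c \<ge> 0"
    by (rule LIMSEQ_le_const[OF lim[of 0]]) (use pos in \<open>auto intro!: exI[of _ 0] less_imp_le\<close>)
  with \<open>c \<noteq> 0\<close> have "c > 0" by simp
  have "conv a x \<in> bs d" if "a \<in> ell1" "x \<in> bs d" for a x
    using that cmod_conv_le[of d, OF pos inc] unfolding bs_iff[of d, OF pos] psum_conv by meson
  then have "multiplier (bs d) = ell1"
    using ell1_if_multiplier[of d, OF pos inc \<open>c > 0\<close> lim] by (auto simp: multiplier_def)
  moreover have "op_norm (bs d) (bs_norm d) (conv a) \<le> ereal (ell1_norm a)" if "a \<in> ell1" for a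
    unfolding op_norm_def
  proof (rule SUP_least)
    fix x assume "x \<in> {x \<in> bs d. bs_norm d x \<le> 1}"
    then have "\<And>m. cmod (psum x m) \<le> 1 * d m"
      using bs_norm_le_iff[of d x 1, OF pos] by (simp add: one_ereal_def)
    from cmod_conv_le[of d, OF pos inc that this]
    show "bs_norm d (conv a x) \<le> ereal (ell1_norm a)"
      by (simp add: bs_norm_le_iff[of d, OF pos] psum_conv)
  qed
  moreover have "ereal (c * ell1_norm a) \<le> op_norm (bs d) (bs_norm d) (conv a)" if "a \<in> ell1" for a
  \<comment> \<open>Comparison with real upper bounds r of the operator norm moves the claim to the
    reals; partial sums of the norm of a are bounded first, then K tends to infinity.\<close>
  proof (rule ereal_le_real)
    fix r assume r: "op_norm (bs d) (bs_norm d) (conv a) \<le> ereal r"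
    have "c * (\<Sum>k<K. cmod (a k)) \<le> r" for K
    proof (rule ccontr)
      assume "\<not> ?thesis"
      then have "eventually (\<lambda>m. functional_norm d a m > r) sequentially"
        by (intro eventually_functional_norm_gt[of d, OF pos lim, where K = K]) simp
      then obtain m where "functional_norm d a m > r"
        by (auto simp: eventually_sequentially)
      moreover have "functional_norm d a m \<le> r"
        using order_trans[OF functional_norm_le_op_norm[of d, OF pos] r] by simp
      ultimately show False by simp
    qed
    moreover have "(\<lambda>K. c * (\<Sum>k<K. cmod (a k))) \<longlonglongrightarrow> c * ell1_norm a"
      unfolding ell1_norm_def using that
      by (intro tendsto_mult_left summable_LIMSEQ) (simp add: ell1_def)
    ultimately have "c * ell1_norm a \<le> r"
      by (intro LIMSEQ_le_const2) auto
    then show "ereal (c * ell1_norm a) \<le> ereal r" by simp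
  qed
  ultimately show ?thesis by blast
qed

end
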